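(* Assume $\Delta\neq 0$ and $\dfrac{a^2}{b}\notin\mathbb{F}_q$. Put $e_0=0$. Then for any integer $e\ge 1$ we have $e_{i-1}<e\le e_i$ for some integer $i\ge 1$, and moreover: (a) if $\Delta\equiv 0\pmod P$, then $\alpha(P^e)=\alpha(P^{e_i})=p^i$; (b) if $\Delta\not\equiv 0\pmod P$, then $\alpha(P^e)=\alpha(P^{e_i})=p^{i-1}\alpha(P)$.
   Context: Let $\mathbb{F}_q$ be the finite field with $q=p^l$ elements, $p$ prime, $l\ge1$. Fix $a,b\in\mathbb{F}_q[x]$ with $b\neq 0$, and put $\Delta=a^2+4b$. The generalized Fibonacci sequence is $F_0=0$, $F_1=1$, $F_n=aF_{n-1}+bF_{n-2}$ for $n\ge 2$. Fix an irreducible polynomial $P\in\mathbb{F}_q[x]$ with $\gcd(b,P)=1$. For a non-constant $M\in\mathbb{F}_q[x]$ with $\gcd(b,M)=1$, the rank $\alpha(M)$ is the least positive integer $n$ with $F_n\equiv 0\pmod M$. For $i\ge 1$, $e_i$ denotes the $i$-th smallest positive integer $e$ such that $\alpha(P^e)\neq\alpha(P^{e+1})$ (under the hypotheses of the claim, all $e_i$ exist). *)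

theory Defs
  imports
    Complex_Main
    "HOL-Library.Cardinality"
    "HOL-Library.Infinite_Set"
    "HOL-Computational_Algebra.Computational_Algebra"
    "HOL-Number_Theory.Cong"
begin

fun gen_fib :: "'a::comm_semiring_1 \<Rightarrow> 'a \<Rightarrow> nat \<Rightarrow> 'a" where
  "gen_fib a b 0 = 0"
| "gen_fib a b (Suc 0) = 1"
| "gen_fib a b (Suc (Suc n)) = a * gen_fib a b (Suc n) + b * gen_fib a b n"

text \<open>Over a finite field the least element below exists whenever \<open>M\<close> is a non-constant
  polynomial coprime to \<open>b\<close>; otherwise the value may be unspecified.\<close>

definition fib_rank :: "'a::{finite,field} poly \<Rightarrow> 'a poly \<Rightarrow> 'a poly \<Rightarrow> nat" where
  "fib_rank a b M = (LEAST n. n > 0 \<and> [gen_fib a b n = 0] (mod M))"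

definition rank_jumps :: "'a::{finite,field} poly \<Rightarrow> 'a poly \<Rightarrow> 'a poly \<Rightarrow> nat set" where
  "rank_jumps a b P = {e. e > 0 \<and> fib_rank a b (P ^ e) \<noteq> fib_rank a b (P ^ (e + 1))}"

text \<open>\<^const>\<open>enumerate\<close> counts from 0, so the \<open>i\<close>-th smallest jump (\<open>i \<ge> 1\<close>) has index
  \<open>i - 1\<close>; the value at 0 is the convention \<open>e\<^sub>0 = 0\<close>. If there are fewer than \<open>i\<close> jumps, the value
  is an unspecified constant.\<close>

fun rank_jump :: "'a::{finite,field} poly \<Rightarrow> 'a poly \<Rightarrow> 'a poly \<Rightarrow> nat \<Rightarrow> nat" where
  "rank_jump a b P 0 = 0"
| "rank_jump a b P (Suc k) = enumerate (rank_jumps a b P) k"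

end

theory Submission
  imports Defs
begin

text \<open>Write \<open>F n\<close> for \<open>gen_fib a b n\<close> and \<open>v\<close> for the exponent of \<open>P\<close> in a polynomial.
The whole statement is read off from the sequence of exponents \<open>v\<^sub>j = v (F (r p\<^sup>j))\<close>, where
\<open>r\<close> is the rank of \<open>P\<close>.

Since \<open>P\<close> does not divide \<open>b\<close>, two consecutive terms are never both divisible by \<open>P\<close>, so the
addition formula makes \<open>F\<close> a divisibility sequence in the strong sense: \<open>P\<^sup>e\<close> divides \<open>F n\<close>
exactly when the rank of \<open>P\<^sup>e\<close> divides \<open>n\<close> (\<open>fib_rank_dvd_iff\<close>).  The addition formula also gives
\<open>F (n m) = m (F (n + 1))\<^bsup>m-1\<^esup> F n\<close> modulo \<open>(F n)\<^sup>2\<close>; for \<open>m = p\<close> the right-hand side vanishes in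
characteristic \<open>p\<close>, so \<open>(F n)\<^sup>2\<close> divides \<open>F (n p)\<close>.  Hence \<open>v\<^sub>j\<^sub>+\<^sub>1 \<ge> 2 v\<^sub>j\<close>, and because
\<open>v\<^sub>0 \<ge> 1\<close> the exponents increase strictly, provided that they are finite.  Finiteness
means \<open>F n \<noteq> 0\<close> for \<open>n > 0\<close>, and this is where the quotient of \<open>a\<^sup>2\<close> by \<open>b\<close> must not be constant
(\<open>gen_fib_nonzero\<close>).

Now let \<open>j\<close> be least with \<open>e \<le> v\<^sub>j\<close>.  The rank of \<open>P\<^sup>e\<close> divides \<open>r p\<^sup>j\<close> and is a multiple of
\<open>r\<close>, so it is \<open>r p\<^sup>i\<close> for some \<open>i \<le> j\<close>, and minimality of \<open>j\<close> forces \<open>i = j\<close>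
(\<open>fib_rank_power_eq\<close>).  Therefore the rank changes precisely after the exponents \<open>v\<^sub>j\<close>, that
is, \<open>e\<^sub>i = v\<^sub>i\<^sub>-\<^sub>1\<close>.  The two cases of the statement differ only in the value of \<open>r\<close>: if \<open>P\<close> divides
the discriminant, the characteristic polynomial of the recurrence has a double root modulo
\<open>P\<close>, so that \<open>F n\<close> is \<open>n\<close> times a unit modulo \<open>P\<close> and \<open>r = p\<close> (\<open>fib_rank_ramified\<close>).\<close>

section \<open>The addition formula and its consequences\<close>

lemma gen_fib_add:
  "gen_fib a b (Suc (n + m)) = gen_fib a b (Suc n) * gen_fib a b (Suc m) + b * gen_fib a b n * gen_fib a b m"
proof (induction n arbitrary: m)
  case 0
  then show ?case by simp
next
  case (Suc n)
  have "gen_fib a b (Suc (Suc n + m)) = gen_fib a b (Suc (n + Suc m))" by simp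
  also have "\<dots> = gen_fib a b (Suc n) * gen_fib a b (Suc (Suc m)) + b * gen_fib a b n * gen_fib a b (Suc m)"
    by (rule Suc.IH)
  also have "\<dots> = gen_fib a b (Suc (Suc n)) * gen_fib a b (Suc m) + b * gen_fib a b (Suc n) * gen_fib a b m"
    by (simp add: algebra_simps)
  finally show ?case .
qed

lemma gen_fib_dvd_diff_add:
  fixes a b :: "'a::comm_ring_1"
  shows "gen_fib a b n dvd gen_fib a b (n + m) - gen_fib a b (Suc n) * gen_fib a b m"
proof (cases m)
  case (Suc k)
  show ?thesis
    unfolding Suc by (simp add: gen_fib_add)
qed simp

text \<open>With \<open>h = b F (n - 1)\<close> one step of the induction reads
\<open>F (N + n) = F (N + 1) F n + h F N\<close> for \<open>N = n m\<close>.  As \<open>F n\<close> divides \<open>F N\<close>, only the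
residues of \<open>F (N + 1)\<close> and \<open>h\<close> modulo \<open>F n\<close> matter modulo \<open>(F n)\<^sup>2\<close>.  They are powers of
\<open>F (n + 1)\<close>, which is why the second congruence is carried along.\<close>

lemma gen_fib_mult_mod_square:
  fixes a b :: "'a::comm_ring_1"
  shows "(gen_fib a b n)\<^sup>2 dvd gen_fib a b (n * Suc m) -
           of_nat (Suc m) * gen_fib a b (Suc n) ^ m * gen_fib a b n
       \<and> gen_fib a b n dvd gen_fib a b (Suc (n * m)) - gen_fib a b (Suc n) ^ m"
proof (cases n)
  case 0
  then show ?thesis by simp
next
  case n: (Suc k)
  define f where "f = gen_fib a b n"
  define g where "g = gen_fib a b (Suc n)"
  define h where "h = b * gen_fib a b k"
  have g: "g = a * f + h" by (simp add: n g_def f_def h_def)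
  have "f\<^sup>2 dvd gen_fib a b (n * Suc m) - of_nat (Suc m) * g ^ m * f
       \<and> f dvd gen_fib a b (Suc (n * m)) - g ^ m"
  proof (induction m)
    case 0
    then show ?case by (simp add: f_def)
  next
    case (Suc m)
    define N where "N = n * Suc m"
    obtain c where c: "gen_fib a b N = of_nat (Suc m) * g ^ m * f + f\<^sup>2 * c"
      using Suc.IH unfolding dvd_def N_def by (metis add_diff_cancel_left' diff_add_cancel add.commute)
    obtain d where d: "gen_fib a b (Suc (n * m)) = g ^ m + f * d"
      using Suc.IH unfolding dvd_def by (metis diff_add_cancel add.commute)
    have "gen_fib a b (Suc (n + n * m)) = g * gen_fib a b (Suc (n * m)) + b * f * gen_fib a b (n * m)"
      by (simp add: gen_fib_add g_def f_def)
    then have sN: "gen_fib a b (Suc N) = g ^ Suc m + f * (g * d + b * gen_fib a b (n * m))"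
      unfolding d by (simp add: N_def algebra_simps)
    have "n * Suc (Suc m) = Suc (N + k)" by (simp add: N_def n)
    then have "gen_fib a b (n * Suc (Suc m)) = gen_fib a b (Suc N) * f + h * gen_fib a b N"
      by (simp only: gen_fib_add) (simp add: n f_def h_def algebra_simps)
    also have "\<dots> = of_nat (Suc (Suc m)) * g ^ Suc m * f
        + f\<^sup>2 * ((g * d + b * gen_fib a b (n * m)) - a * of_nat (Suc m) * g ^ m + h * c)"
      by (simp add: sN c g algebra_simps power2_eq_square)
    finally show ?case using sN by (simp add: N_def)
  qed
  then show ?thesis by (simp add: f_def g_def)
qed

lemma gen_fib_square_dvd_char:
  fixes a b :: "'a::comm_ring_1"
  assumes "of_nat p = (0::'a)" "p > 0"
  shows "(gen_fib a b n)\<^sup>2 dvd gen_fib a b (n * p)"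
  using gen_fib_mult_mod_square[of a b n "p - 1"] assms by simp

section \<open>Divisibility by powers of a prime\<close>

text \<open>A common prime divisor of two neighbouring terms that does not divide \<open>b\<close> would descend
through the recurrence to \<open>F 1 = 1\<close>.\<close>

lemma prime_not_dvd_consecutive_gen_fib:
  fixes a b :: "'a::comm_ring_1"
  assumes "prime_elem P" "\<not> P dvd b" "P dvd gen_fib a b n"
  shows "\<not> P dvd gen_fib a b (Suc n)"
  using assms(3)
proof (induction n)
  case 0
  show ?case using assms(1) by (simp add: prime_elem_def)
next
  case (Suc n)
  show ?case
  proof
    assume "P dvd gen_fib a b (Suc (Suc n))"
    with Suc.prems have "P dvd b * gen_fib a b n"
      by (simp add: dvd_add_right_iff)
    with assms have "P dvd gen_fib a b n" by (simp add: prime_elem_dvd_mult_iff)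
    with Suc show False by blast
  qed
qed

lemma prime_elem_power_dvd_cancel:
  fixes P :: "'a::algebraic_semidom"
  assumes "prime_elem P" "\<not> P dvd x"
  shows "P ^ e dvd x * y \<longleftrightarrow> P ^ e dvd y"
proof
  assume "P ^ e dvd x * y"
  then obtain i j where ij: "i + j = e" "P ^ i dvd x" "P ^ j dvd y"
    using prime_elem_power_dvd_prod[OF _ assms(1)] by blast
  have "i = 0"
    using ij(2) assms(2) by (cases i) (auto dest: dvd_mult_left)
  with ij show "P ^ e dvd y" by simp
qed simp

text \<open>Modulo \<open>P\<^sup>e\<close>, a shift by \<open>n\<close> multiplies the sequence by \<open>F (n + 1)\<close>, which is prime to \<open>P\<close>.\<close>

lemma power_dvd_gen_fib_shift:
  fixes a b :: "'a::{comm_ring_1,algebraic_semidom}"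
  assumes "prime_elem P" "\<not> P dvd b" "e \<ge> 1" "P ^ e dvd gen_fib a b n"
  shows "P ^ e dvd gen_fib a b (n + m) \<longleftrightarrow> P ^ e dvd gen_fib a b m"
proof -
  have "P dvd gen_fib a b n" using assms(3,4) by (meson dvd_power dvd_trans less_le_trans zero_less_one)
  then have nd: "\<not> P dvd gen_fib a b (Suc n)" using assms prime_not_dvd_consecutive_gen_fib by blast
  have "P ^ e dvd gen_fib a b (n + m) - gen_fib a b (Suc n) * gen_fib a b m"
    using gen_fib_dvd_diff_add assms(4) dvd_trans by blast
  then have "P ^ e dvd gen_fib a b (n + m) \<longleftrightarrow> P ^ e dvd gen_fib a b (Suc n) * gen_fib a b m"
    using dvd_add_right_iff[of "P ^ e" _ "gen_fib a b (Suc n) * gen_fib a b m"] by fastforce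
  then show ?thesis using prime_elem_power_dvd_cancel[OF assms(1) nd] by simp
qed

section \<open>Nonvanishing of the sequence\<close>

text \<open>For \<open>n = 2 k + 1\<close> the term is a form of degree \<open>k\<close> in \<open>a\<^sup>2\<close> and \<open>b\<close> in which the
coefficient of \<open>a\<^bsup>2k\<^esup>\<close> is 1; for \<open>n = 2 k + 2\<close> the same holds after division by \<open>a\<close>.  A common
factor \<open>g\<close> of \<open>a\<^sup>2\<close> and \<open>b\<close> can thus be pulled out.  In the remaining form in \<open>A\<close> and \<open>B\<close> the
leading summand \<open>A\<^sup>k\<close> is the only one without a factor \<open>B\<close>, and it dominates in degree if
\<open>A\<close> has the larger degree.  The two properties treat the finite poles of \<open>A/B\<close> and the pole
at infinity.\<close>

lemma gen_fib_lowest_terms: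
  fixes a b A B g :: "'a::field poly"
  assumes "a\<^sup>2 = g * A" "b = g * B"
  shows "\<exists>U V. gen_fib a b (2 * k + 1) = g ^ k * U \<and> gen_fib a b (2 * k + 2) = a * g ^ k * V
     \<and> B dvd U - A ^ k \<and> B dvd V - A ^ k
     \<and> (degree B < degree A \<longrightarrow> U \<noteq> 0 \<and> V \<noteq> 0 \<and> degree U = k * degree A \<and> degree V = k * degree A)"
proof (induction k)
  case 0
  show ?case
    by (intro exI[of _ 1]) (simp add: numeral_2_eq_2)
next
  case (Suc k)
  then obtain U V where
    U: "gen_fib a b (2 * k + 1) = g ^ k * U" and V: "gen_fib a b (2 * k + 2) = a * g ^ k * V"
    and B: "B dvd U - A ^ k" "B dvd V - A ^ k"
    and deg: "degree B < degree A \<Longrightarrow> U \<noteq> 0 \<and> V \<noteq> 0 \<and> degree U = k * degree A \<and> degree V = k * degree A"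
    by blast
  define U' where "U' = A * V + B * U"
  define V' where "V' = U' + B * V"
  have "gen_fib a b (2 * Suc k + 1) = a * gen_fib a b (2 * k + 2) + b * gen_fib a b (2 * k + 1)"
    by simp
  also have "\<dots> = a\<^sup>2 * (g ^ k * V) + b * (g ^ k * U)"
    unfolding U V by (simp add: power2_eq_square algebra_simps)
  also have "\<dots> = g ^ Suc k * U'"
    unfolding assms U'_def by (simp add: algebra_simps)
  finally have 1: "gen_fib a b (2 * Suc k + 1) = g ^ Suc k * U'" .
  have "gen_fib a b (2 * Suc k + 2) = a * gen_fib a b (2 * Suc k + 1) + b * gen_fib a b (2 * k + 2)"
    by simp
  also have "\<dots> = a * g ^ Suc k * V'"
    unfolding 1 V V'_def using assms(2) by (simp add: algebra_simps)
  finally have 2: "gen_fib a b (2 * Suc k + 2) = a * g ^ Suc k * V'" .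
  have "U' - A ^ Suc k = A * (V - A ^ k) + B * U" by (simp add: U'_def algebra_simps)
  then have 3: "B dvd U' - A ^ Suc k" using B by simp
  have "V' - A ^ Suc k = (U' - A ^ Suc k) + B * V" by (simp add: V'_def)
  then have 4: "B dvd V' - A ^ Suc k" using 3 by (metis dvd_add dvd_triv_left)
  have 5: "U' \<noteq> 0 \<and> V' \<noteq> 0 \<and> degree U' = Suc k * degree A \<and> degree V' = Suc k * degree A"
    if d: "degree B < degree A"
  proof -
    note D = deg[OF d]
    from d have "A \<noteq> 0" by auto
    with D have dA: "degree (A * V) = Suc k * degree A" by (simp add: degree_mult_eq)
    have "degree (B * U) < Suc k * degree A" "degree (B * V) < Suc k * degree A"
      using D d degree_mult_le[of B U] degree_mult_le[of B V] by auto
    then have "degree U' = Suc k * degree A" "degree V' = Suc k * degree A"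
      unfolding V'_def U'_def using dA by (simp_all add: degree_add_eq_left)
    moreover have "Suc k * degree A > 0" using d by simp
    ultimately show ?thesis by (metis degree_0 less_numeral_extra(3))
  qed
  show ?case using 1 2 3 4 5 by blast
qed

text \<open>A representation whose denominator \<open>B\<close> has least degree is reduced, since moving a common
factor of \<open>A\<close> and \<open>B\<close> that is not a unit into \<open>g\<close> would lower that degree.\<close>

lemma poly_fraction_lowest_terms:
  fixes x y :: "'a::field poly"
  assumes "y \<noteq> 0"
  obtains g A B where "x = g * A" "y = g * B" "coprime A B"
proof -
  let ?Q = "\<lambda>(g, A, B). x = g * A \<and> y = g * B"
  have "?Q (1, x, y)" by simp
  from ex_has_least_nat[of ?Q, OF this, of "\<lambda>t. degree (snd (snd t))"]
  obtain t where t: "?Q t" "\<And>s. ?Q s \<Longrightarrow> degree (snd (snd t)) \<le> degree (snd (snd s))"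
    by (elim exE conjE) (rule that, assumption, erule allE, erule mp)
  obtain g A B where tt: "t = (g, A, B)" by (cases t)
  have xy: "x = g * A" "y = g * B" using t(1) by (auto simp: tt)
  have "coprime A B"
  proof (rule coprimeI)
    fix d assume "d dvd A" "d dvd B"
    then obtain A' B' where AB: "A = d * A'" "B = d * B'" by (auto elim!: dvdE)
    have "?Q (g * d, A', B')" using xy AB by (simp add: mult.assoc)
    from t(2)[OF this] have "degree B \<le> degree B'" by (simp add: tt)
    moreover have "d \<noteq> 0" "B' \<noteq> 0" using xy AB assms by auto
    ultimately have "degree d = 0" by (simp add: AB degree_mult_eq)
    with \<open>d \<noteq> 0\<close> show "is_unit d" by (simp add: is_unit_iff_degree)
  qed
  with xy that show ?thesis by blast
qed

lemma poly_prime_divisor_exists: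
  fixes q :: "'a::field poly"
  assumes "degree q \<noteq> 0"
  shows "\<exists>P. prime_elem P \<and> P dvd q"
  using assms
proof (induction "degree q" arbitrary: q rule: less_induct)
  case less
  then have "q \<noteq> 0" by auto
  with less.prems have "\<not> is_unit q" by (simp add: is_unit_iff_degree)
  show ?case
  proof (cases "irreducible q")
    case True
    then have "prime_elem q" by (rule field_poly_irreducible_imp_prime)
    then show ?thesis by (intro exI[of _ q]) simp
  next
    case False
    then obtain x y where xy: "q = x * y" "\<not> is_unit x" "\<not> is_unit y"
      using \<open>q \<noteq> 0\<close> \<open>\<not> is_unit q\<close> by (auto simp: irreducible_def)
    moreover have "x \<noteq> 0" "y \<noteq> 0" using xy \<open>q \<noteq> 0\<close> by auto
    ultimately have "degree x \<noteq> 0" "degree x < degree q"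
      by (auto simp: degree_mult_eq is_unit_iff_degree)
    then obtain P where "prime_elem P" "P dvd x" using less.hyps by blast
    then show ?thesis using xy(1) by auto
  qed
qed

text \<open>A nonconstant rational function has a pole.  At a pole of \<open>a\<^sup>2/b\<close> the leading summand of the
form in \<open>gen_fib_lowest_terms\<close> cannot be cancelled by the others: a vanishing term would make \<open>B\<close>
divide \<open>A\<^sup>k\<close>, so that \<open>B\<close> is constant by coprimality, and then \<open>A\<close> is constant too by the
degree formula.\<close>

lemma gen_fib_nonzero:
  fixes a b :: "'a::field poly"
  assumes "b \<noteq> 0" "\<And>c. a\<^sup>2 \<noteq> smult c b" "n > 0"
  shows "gen_fib a b n \<noteq> 0"
proof
  assume z: "gen_fib a b n = 0"
  obtain g A B where r: "a\<^sup>2 = g * A" "b = g * B" "coprime A B"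
    using poly_fraction_lowest_terms[OF assms(1)] by metis
  have "a \<noteq> 0" using assms(2)[of 0] by auto
  have "g \<noteq> 0" using r assms by auto
  have "\<exists>k. n = 2 * k + 1 \<or> n = 2 * k + 2"
    using \<open>n > 0\<close> by presburger
  then obtain k where k: "n = 2 * k + 1 \<or> n = 2 * k + 2" ..
  from gen_fib_lowest_terms[OF r(1,2), of k] k z \<open>a \<noteq> 0\<close> \<open>g \<noteq> 0\<close>
  have B: "B dvd A ^ k" and nd: "\<not> degree B < degree A"
    by auto
  have "B \<noteq> 0" using r(2) assms(1) by auto
  have "degree B = 0"
  proof (rule ccontr)
    assume "degree B \<noteq> 0"
    then obtain Q where Q: "prime_elem Q" "Q dvd B" using poly_prime_divisor_exists by blast
    with B have "Q dvd A" by (meson dvd_trans prime_elem_dvd_power)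
    with Q r(3) have "is_unit Q" by (meson coprime_common_divisor)
    with Q show False by (simp add: prime_elem_not_unit)
  qed
  then obtain u where u: "B = [:u:]" "u \<noteq> 0" using \<open>B \<noteq> 0\<close> by (auto elim: degree_eq_zeroE)
  obtain v where "A = [:v:]"
    using nd \<open>degree B = 0\<close> by (auto elim: degree_eq_zeroE)
  then have "a\<^sup>2 = smult (v / u) b" using u r by simp
  with assms(2) show False by blast
qed

section \<open>Ranks of prime powers\<close>

lemma finite_poly_degree_le: "finite {q :: 'a::{finite,zero} poly. degree q \<le> n}"
proof -
  have "{q :: 'a poly. degree q \<le> n} \<subseteq> Poly ` {xs. set xs \<subseteq> UNIV \<and> length xs \<le> Suc n}"
  proof
    fix q :: "'a poly" assume "q \<in> {q. degree q \<le> n}"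
    then have "length (coeffs q) \<le> Suc n" by (cases "q = 0") (auto simp: length_coeffs_degree)
    then show "q \<in> Poly ` {xs. set xs \<subseteq> UNIV \<and> length xs \<le> Suc n}"
      by (intro image_eqI[of _ _ "coeffs q"]) auto
  qed
  moreover have "finite {xs :: 'a list. set xs \<subseteq> UNIV \<and> length xs \<le> Suc n}"
    by (rule finite_lists_length_le) simp
  ultimately show ?thesis by (meson finite_imageI finite_subset)
qed

text \<open>There are finitely many pairs of residues modulo \<open>P\<close>, so some pair of consecutive terms
recurs.  As \<open>b\<close> is invertible modulo \<open>P\<close>, the recurrence can be run backwards from such a
repetition until the first pair starts at index 0, where the term is 0.\<close>

lemma prime_divides_some_gen_fib:
  fixes a b P :: "'a::{finite,field} poly"
  assumes "prime_elem P" "\<not> P dvd b"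
  shows "\<exists>n>0. P dvd gen_fib a b n"
proof -
  define f where "f n = (gen_fib a b n mod P, gen_fib a b (Suc n) mod P)" for n
  have "P \<noteq> 0" using assms by auto
  then have "degree (q mod P) \<le> degree P" for q
    using degree_mod_less[of P q] by auto
  then have "range f \<subseteq> {q. degree q \<le> degree P} \<times> {q. degree q \<le> degree P}"
    by (auto simp: f_def)
  then have "finite (range f)" by (rule finite_subset) (simp add: finite_poly_degree_le)
  then have "\<not> inj f" using finite_imageD infinite_UNIV_nat by blast
  then obtain i j where "i < j" "f i = f j" unfolding inj_def by (metis linorder_neqE_nat)
  then show ?thesis
  proof (induction i arbitrary: j)
    case 0
    then show ?case by (auto simp: f_def mod_eq_dvd_iff mod_eq_0_iff_dvd)
  next
    case (Suc i)
    then obtain j' where j: "j = Suc j'" "i < j'" using Suc_lessE by metis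
    let ?F = "gen_fib a b"
    from Suc.prems have 1: "P dvd ?F (Suc i) - ?F (Suc j')" and
      2: "P dvd ?F (Suc (Suc i)) - ?F (Suc (Suc j'))"
      unfolding f_def j by (simp_all add: mod_eq_dvd_iff)
    have "b * (?F i - ?F j') = (?F (Suc (Suc i)) - ?F (Suc (Suc j'))) - a * (?F (Suc i) - ?F (Suc j'))"
      by (simp add: algebra_simps)
    with 1 2 have "P dvd b * (?F i - ?F j')" by (metis dvd_diff dvd_mult)
    with assms have "P dvd ?F i - ?F j'" by (simp add: prime_elem_dvd_mult_iff)
    with 1 have "f i = f j'" by (simp add: f_def mod_eq_dvd_iff)
    with Suc.IH j show ?case by blast
  qed
qed

text \<open>If \<open>a\<^sup>2 + 4 b\<close> vanishes and 2 is invertible, then \<open>a/2\<close> is a double root of the characteristic polynomial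
and \<open>F (n + 1) = (n + 1) (a/2)\<^sup>n\<close>.  Clearing the denominators gives a statement that makes sense
in every commutative ring.\<close>

lemma gen_fib_mod_discriminant:
  fixes a b :: "'a::comm_ring_1"
  shows "a\<^sup>2 + 4 * b dvd 2 ^ n * gen_fib a b (Suc n) - of_nat (Suc n) * a ^ n"
proof (induction n rule: less_induct)
  case (less n)
  consider "n = 0" | "n = 1" | k where "n = Suc (Suc k)" by (metis One_nat_def not0_implies_Suc)
  then show ?case
  proof cases
    case 3
    let ?F = "gen_fib a b"
    have "2 ^ n * ?F (Suc n) - of_nat (Suc n) * a ^ n
      = 2 * a * (2 ^ Suc k * ?F (Suc (Suc k)) - of_nat (Suc (Suc k)) * a ^ Suc k)
        + 4 * b * (2 ^ k * ?F (Suc k) - of_nat (Suc k) * a ^ k)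
        + (a\<^sup>2 + 4 * b) * of_nat (Suc k) * a ^ k"
      unfolding 3 by (simp add: algebra_simps power2_eq_square)
    then show ?thesis using less.IH[of k] less.IH[of "Suc k"] 3 by (auto intro!: dvd_add)
  qed auto
qed

text \<open>By \<open>power_dvd_gen_fib_shift\<close> divisibility of \<open>F n\<close> by \<open>P\<^sup>e\<close> depends only on \<open>n\<close> modulo the rank,
and no positive index below the rank qualifies.  The index \<open>n0\<close> witnesses that the rank exists.\<close>

lemma fib_rank_dvd_iff:
  assumes "prime_elem P" "\<not> P dvd b" "e \<ge> 1" "n0 > 0" "P ^ e dvd gen_fib a b n0"
  shows "P ^ e dvd gen_fib a b n \<longleftrightarrow> fib_rank a b (P ^ e) dvd n"
proof -
  define r where "r = fib_rank a b (P ^ e)"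
  have eq: "r = (LEAST n. n > 0 \<and> P ^ e dvd gen_fib a b n)"
    by (simp add: r_def fib_rank_def cong_0_iff)
  have r: "r > 0" "P ^ e dvd gen_fib a b r"
    using LeastI[of "\<lambda>n. n > 0 \<and> P ^ e dvd gen_fib a b n" n0] assms(4,5) unfolding eq by auto
  have shift: "P ^ e dvd gen_fib a b (r * q + s) \<longleftrightarrow> P ^ e dvd gen_fib a b s" for q s
  proof (induction q)
    case (Suc q)
    have "r * Suc q + s = r + (r * q + s)" by simp
    then show ?case using power_dvd_gen_fib_shift[OF assms(1-3) r(2)] Suc.IH by metis
  qed simp
  have "P ^ e dvd gen_fib a b n \<longleftrightarrow> P ^ e dvd gen_fib a b (n mod r)"
    using shift[of "n div r" "n mod r"] by simp
  also have "\<dots> \<longleftrightarrow> n mod r = 0"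
  proof
    assume "P ^ e dvd gen_fib a b (n mod r)"
    then show "n mod r = 0"
      using not_less_Least[of "n mod r" "\<lambda>n. n > 0 \<and> P ^ e dvd gen_fib a b n"] r(1)
      unfolding eq[symmetric] by auto
  qed simp
  finally show ?thesis by (simp add: r_def mod_eq_0_iff_dvd)
qed

lemma poly_valuation_exists:
  fixes P x :: "'a::field poly"
  assumes "degree P > 0" "x \<noteq> 0"
  shows "\<exists>v. \<forall>e. P ^ e dvd x \<longleftrightarrow> e \<le> v"
proof -
  have bd: "e \<le> degree x" if "P ^ e dvd x" for e
  proof -
    have "P \<noteq> 0" using assms(1) by auto
    then have "e * degree P \<le> degree x"
      using dvd_imp_degree_le[OF that assms(2)] by (simp add: degree_power_eq mult.commute)
    moreover have "e \<le> e * degree P" using assms(1) by simp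
    ultimately show ?thesis by linarith
  qed
  define v where "v = (GREATEST e. P ^ e dvd x)"
  have "P ^ v dvd x" unfolding v_def
    by (rule GreatestI_nat[of _ 0 "degree x"]) (auto intro: bd)
  moreover have "e \<le> v" if "P ^ e dvd x" for e unfolding v_def
    by (rule Greatest_le_nat[of _ _ "degree x"]) (auto intro: bd that)
  ultimately show ?thesis by (meson dvd_trans le_imp_power_dvd)
qed

lemma enumerate_range_strict_mono:
  fixes v :: "nat \<Rightarrow> nat"
  assumes "strict_mono v"
  shows "enumerate (range v) j = v j"
proof (induction j)
  case 0
  show ?case unfolding enumerate_0
    by (rule Least_equality) (use assms in \<open>auto simp: strict_mono_less_eq\<close>)
next
  case (Suc j)
  have "infinite (range v)" using assms strict_mono_imp_inj_on by (simp add: range_inj_infinite strict_mono_imp_inj_on)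
  then show ?case unfolding enumerate_Suc''[OF \<open>infinite (range v)\<close>] Suc
    by (intro Least_equality) (use assms in \<open>auto simp: strict_mono_less_eq strict_mono_less\<close>)
qed

text \<open>Translation by 1 permutes the field, so adding up all elements shows that the number of
elements vanishes in the field; hence the characteristic divides \<open>p\<close>.\<close>

lemma of_nat_poly_eq_0_iff_char:
  assumes "prime p" "CARD('a::{finite,field}) = p ^ l"
  shows "(of_nat n :: 'a poly) = 0 \<longleftrightarrow> p dvd n"
proof -
  have "(\<Sum>x\<in>UNIV. x + 1 :: 'a) = (\<Sum>x\<in>UNIV. x)"
    by (rule sum.reindex_bij_betw) (rule bij_betw_byWitness[of _ "\<lambda>x. x - 1"], auto)
  then have "of_nat (p ^ l) = (0::'a)"
    by (simp add: sum.distrib flip: assms(2))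
  then have "CHAR('a) dvd p" by (simp flip: of_nat_eq_0_iff_char_dvd)
  moreover have "CHAR('a) \<noteq> 1" using of_nat_CHAR[where ?'a='a] by (metis of_nat_1 zero_neq_one)
  ultimately have "CHAR('a) = p" using assms(1) by (auto simp: prime_nat_iff)
  then show ?thesis by (simp add: of_nat_poly of_nat_eq_0_iff_char_dvd)
qed

lemma prime_dvd_of_nat_poly_iff:
  fixes P :: "'a::{finite,field} poly"
  assumes "prime_elem P" "prime p" "CARD('a) = p ^ l"
  shows "P dvd of_nat n \<longleftrightarrow> p dvd n"
proof (cases "p dvd n")
  case True
  then have "of_nat n = (0 :: 'a poly)" using of_nat_poly_eq_0_iff_char[OF assms(2,3)] by simp
  then show ?thesis using True by simp
next
  case False
  then have "of_nat n \<noteq> (0 :: 'a poly)" using of_nat_poly_eq_0_iff_char[OF assms(2,3)] by simp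
  then have "is_unit (of_nat n :: 'a poly)" by (simp add: of_nat_poly is_unit_iff_degree)
  then show ?thesis using False assms(1) by (meson dvd_unit_imp_unit prime_elem_not_unit)
qed

text \<open>For odd \<open>p\<close> the congruence \<open>gen_fib_mod_discriminant\<close> gives that \<open>P\<close> divides \<open>F n\<close> exactly when \<open>p\<close>
divides \<open>n\<close>, since 2 and \<open>a\<close> are units modulo \<open>P\<close>.  For \<open>p = 2\<close> that congruence says
nothing about the terms from \<open>F 2\<close> on, but then the discriminant is \<open>a\<^sup>2\<close> and \<open>F 2 = a\<close>.\<close>

lemma fib_rank_ramified:
  fixes a b P :: "'a::{finite,field} poly"
  assumes P: "prime_elem P" "\<not> P dvd b" and p: "prime p" "CARD('a) = p ^ l"
    and disc: "P dvd a\<^sup>2 + 4 * b"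
  shows "fib_rank a b P = p"
proof (cases "p = 2")
  case True
  have "(2 :: 'a poly) = 0" using of_nat_poly_eq_0_iff_char[OF p, of 2] True by simp
  then have "(4 :: 'a poly) = 0" by (metis mult_2_right mult_zero_right numeral_Bit0 numeral_plus_numeral one_add_one add_0)
  then have "P dvd a" using disc P(1) by (simp add: prime_elem_dvd_power_iff)
  moreover have "\<not> P dvd 1" using P(1) by (simp add: prime_elem_not_unit)
  ultimately show ?thesis unfolding fib_rank_def cong_0_iff True
    by (intro Least_equality) (auto simp: numeral_2_eq_2 not_less_eq_eq[symmetric] le_Suc_eq)
next
  case False
  then have "\<not> p dvd 2" using p(1) by (metis prime_nat_iff two_is_prime_nat not_prime_1 primes_dvd_imp_eq)
  then have two: "\<not> P dvd 2" using prime_dvd_of_nat_poly_iff[OF P(1) p, of 2] by simp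
  have a: "\<not> P dvd a"
  proof
    assume "P dvd a"
    then have "P dvd a\<^sup>2" by (simp add: power2_eq_square)
    with disc have "P dvd 2 * (2 * b)" by (simp add: dvd_add_right_iff)
    with P two show False by (metis prime_elem_dvd_multD)
  qed
  have "P dvd gen_fib a b n \<longleftrightarrow> p dvd n" if "n > 0" for n
  proof -
    obtain k where n: "n = Suc k" using \<open>n > 0\<close> by (cases n) auto
    have "P dvd 2 ^ k * gen_fib a b n - of_nat n * a ^ k"
      using gen_fib_mod_discriminant[of a b k] disc dvd_trans unfolding n by blast
    then have "P dvd 2 ^ k * gen_fib a b n \<longleftrightarrow> P dvd of_nat n * a ^ k"
      using dvd_add_right_iff[of P _ "of_nat n * a ^ k"] by fastforce
    moreover have "\<not> P dvd 2 ^ k" "\<not> P dvd a ^ k"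
      using two a P(1) prime_elem_dvd_power by blast+
    ultimately show ?thesis
      using P(1) prime_dvd_of_nat_poly_iff[OF P(1) p, of n] by (simp add: prime_elem_dvd_mult_iff)
  qed
  then show ?thesis unfolding fib_rank_def cong_0_iff
    by (intro Least_equality) (use p(1) in \<open>auto simp: prime_gt_0_nat dvd_imp_le\<close>)
qed

text \<open>Here \<open>v j\<close> is the exponent of \<open>P\<close> in the term with index \<open>r p\<^sup>j\<close>, where \<open>r\<close> is the rank of \<open>P\<close>.
It at least doubles when \<open>j\<close> grows by one, and the divisors of \<open>r p\<^sup>j\<close> that are multiples of
\<open>r\<close> are the \<open>r p\<^sup>i\<close> with \<open>i \<le> j\<close>, which leaves no other value for the rank of \<open>P\<^sup>e\<close>.\<close>

lemma fib_rank_power_eq: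
  fixes a b P :: "'a::{finite,field} poly"
  assumes P: "prime_elem P" "\<not> P dvd b" and p: "prime p" "CARD('a) = p ^ l"
    and b: "b \<noteq> 0" and nonconst: "\<And>c. a\<^sup>2 \<noteq> smult c b"
  obtains v :: "nat \<Rightarrow> nat" where "strict_mono v" "v 0 > 0"
    "\<And>e. e \<ge> 1 \<Longrightarrow> fib_rank a b (P ^ e) = fib_rank a b P * p ^ (LEAST j. e \<le> v j)"
proof -
  define r where "r = fib_rank a b P"
  have "p > 0" using p(1) by (simp add: prime_gt_0_nat)
  have rank_P: "P dvd gen_fib a b n \<longleftrightarrow> r dvd n" for n
    using fib_rank_dvd_iff[OF P, of 1] prime_divides_some_gen_fib[OF P, of a] unfolding r_def by auto
  have "r > 0" using rank_P prime_divides_some_gen_fib[OF P] by (metis dvd_0_left_iff gr0I)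
  have "degree P > 0"
    using P(1) by (metis is_unit_iff_degree prime_elem_def gr0I)
  have "\<exists>v. \<forall>e. P ^ e dvd gen_fib a b (r * p ^ j) \<longleftrightarrow> e \<le> v" for j
    using \<open>degree P > 0\<close> \<open>r > 0\<close> \<open>p > 0\<close>
    by (intro poly_valuation_exists gen_fib_nonzero b nonconst) auto
  then obtain v where v: "\<And>j e. P ^ e dvd gen_fib a b (r * p ^ j) \<longleftrightarrow> e \<le> v j" by metis
  have pos: "v j \<ge> 1" for j using v[of 1 j] rank_P by simp
  have step: "v j < v (Suc j)" for j
  proof -
    have "(P ^ v j)\<^sup>2 dvd (gen_fib a b (r * p ^ j))\<^sup>2" using v by (simp add: dvd_power_same)
    also have "\<dots> dvd gen_fib a b (r * p ^ j * p)"
      by (rule gen_fib_square_dvd_char) (use of_nat_poly_eq_0_iff_char[OF p] \<open>p > 0\<close> in auto)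
    finally have "2 * v j \<le> v (Suc j)"
      using v[of "2 * v j" "Suc j"] by (simp add: power_mult mult.commute mult.left_commute power_even_eq)
    with pos[of j] show ?thesis by simp
  qed
  then have mono: "strict_mono v" by (simp add: strict_mono_Suc_iff)
  have rank: "fib_rank a b (P ^ e) = r * p ^ (LEAST j. e \<le> v j)" if e: "e \<ge> 1" for e
  proof -
    define j where "j = (LEAST j. e \<le> v j)"
    have ej: "e \<le> v j" unfolding j_def
      by (rule LeastI[of _ e]) (rule strict_mono_imp_increasing[OF mono])
    define s where "s = fib_rank a b (P ^ e)"
    have s: "P ^ e dvd gen_fib a b n \<longleftrightarrow> s dvd n" for n
      unfolding s_def by (rule fib_rank_dvd_iff[OF P e, of "r * p ^ j"]) (use \<open>r > 0\<close> \<open>p > 0\<close> ej v in auto)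
    have "s dvd r * p ^ j" using s ej v by blast
    moreover have "P dvd gen_fib a b s" using s[of s] e by (metis dvd_power dvd_refl dvd_trans less_le_trans zero_less_one)
    then obtain t where t: "s = r * t" using rank_P by (auto elim: dvdE)
    ultimately have "t dvd p ^ j" using \<open>r > 0\<close> by simp
    then obtain i where i: "i \<le> j" "t = p ^ i" using divides_primepow_nat[OF p(1)] by blast
    then have "e \<le> v i" using s[of s] t v by simp
    then have "j \<le> i" unfolding j_def by (rule Least_le)
    with i t show ?thesis by (simp add: s_def j_def)
  qed
  show ?thesis using that[OF mono] rank pos[of 0] by (simp add: r_def)
qed

section \<open>The jumps of the rank\<close>

text \<open>The rank of \<open>P\<^sup>e\<close> depends on \<open>e\<close> only through the least \<open>j\<close> with \<open>e \<le> v j\<close>, and this index moves,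
by exactly one, when \<open>e\<close> passes from a value of \<open>v\<close> to its successor.\<close>

lemma rank_jumps_eq_range:
  fixes a b P :: "'a::{finite,field} poly" and v :: "nat \<Rightarrow> nat"
  assumes v: "strict_mono v" "v 0 > 0" and r: "r > 0" "p > 1"
    and rank: "\<And>e. e \<ge> 1 \<Longrightarrow> fib_rank a b (P ^ e) = r * p ^ (LEAST j. e \<le> v j)"
  shows "rank_jumps a b P = range v"
proof -
  have L: "(LEAST j. v i \<le> v j) = i" for i
    by (rule Least_equality) (use v in \<open>auto simp: strict_mono_less_eq\<close>)
  have L1: "(LEAST j. v i + 1 \<le> v j) = Suc i" for i
    by (rule Least_equality) (use v in \<open>auto simp: strict_mono_less Suc_le_eq\<close>)
  have vpos: "v i \<ge> 1" for i using v strict_mono_less_eq[OF v(1), of 0 i] by simp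
  have "v i \<in> rank_jumps a b P" for i
    using rank[of "v i"] rank[of "v i + 1"] vpos[of i] r unfolding L L1 by (simp add: rank_jumps_def)
  moreover have "e \<in> range v" if "e \<in> rank_jumps a b P" for e
  proof (rule ccontr)
    assume "e \<notin> range v"
    then have "e \<le> v j \<longleftrightarrow> e + 1 \<le> v j" for j by (metis Suc_eq_plus1 Suc_le_eq le_less range_eqI)
    then have "fib_rank a b (P ^ e) = fib_rank a b (P ^ (e + 1))"
      using that rank[of e] rank[of "e + 1"] by (simp add: rank_jumps_def)
    with that show False by (simp add: rank_jumps_def)
  qed
  ultimately show ?thesis by blast
qed

theorem theorem4p6:
  fixes a b P \<Delta> :: "'a::{finite,field} poly" and p l e :: nat
  assumes "prime p" and "l \<ge> 1" and "CARD('a) = p ^ l"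
    and "b \<noteq> 0"
    and "\<Delta> = a\<^sup>2 + 4 * b"
    and "irreducible P" and "coprime b P"
    and "\<Delta> \<noteq> 0"
    and "Fract (a\<^sup>2) b \<notin> range (\<lambda>c::'a. Fract [:c:] 1)"
    and "e \<ge> 1"
  shows "\<exists>i\<ge>1. rank_jump a b P (i - 1) < e \<and> e \<le> rank_jump a b P i
    \<and> ([\<Delta> = 0] (mod P) \<longrightarrow>
         fib_rank a b (P ^ e) = fib_rank a b (P ^ rank_jump a b P i)
       \<and> fib_rank a b (P ^ rank_jump a b P i) = p ^ i)
    \<and> (\<not> [\<Delta> = 0] (mod P) \<longrightarrow>
         fib_rank a b (P ^ e) = fib_rank a b (P ^ rank_jump a b P i)
       \<and> fib_rank a b (P ^ rank_jump a b P i) = p ^ (i - 1) * fib_rank a b P)"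
proof -
  note p = \<open>prime p\<close> \<open>CARD('a) = p ^ l\<close>
  have prime: "prime_elem P" using \<open>irreducible P\<close> by (rule field_poly_irreducible_imp_prime)
  have Pb: "\<not> P dvd b" using coprime_common_divisor[OF \<open>coprime b P\<close>, of P] prime prime_elem_not_unit by auto
  have nonconst: "a\<^sup>2 \<noteq> smult c b" for c
  proof
    assume "a\<^sup>2 = smult c b"
    then have "Fract (a\<^sup>2) b = Fract [:c:] 1" using \<open>b \<noteq> 0\<close> by (simp add: eq_fract)
    with assms(9) show False by blast
  qed
  obtain v :: "nat \<Rightarrow> nat" where v: "strict_mono v" "v 0 > 0"
    and rank: "\<And>e. e \<ge> 1 \<Longrightarrow> fib_rank a b (P ^ e) = fib_rank a b P * p ^ (LEAST j. e \<le> v j)"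
    using fib_rank_power_eq[OF prime Pb p \<open>b \<noteq> 0\<close> nonconst] by metis
  have "fib_rank a b P > 0"
    using fib_rank_dvd_iff[OF prime Pb, of 1] prime_divides_some_gen_fib[OF prime Pb]
    by (metis One_nat_def dvd_0_left_iff gr0I le_refl power_one_right)
  then have "rank_jumps a b P = range v"
    using rank_jumps_eq_range[OF v _ _ rank] prime_gt_1_nat[OF p(1)] by blast
  then have jump: "rank_jump a b P (Suc j) = v j" for j
    by (simp add: enumerate_range_strict_mono[OF v(1)])
  define j where "j = (LEAST j. e \<le> v j)"
  have "e \<le> v j" unfolding j_def
    by (rule LeastI[of _ e]) (rule strict_mono_imp_increasing[OF v(1)])
  have "rank_jump a b P j < e"
  proof (cases j)
    case (Suc k)
    then show ?thesis using not_less_Least[of k "\<lambda>j. e \<le> v j"] unfolding j_def[symmetric] by (simp add: jump del: rank_jump.simps)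
  qed (use \<open>e \<ge> 1\<close> in simp)
  have "(LEAST i. v j \<le> v i) = j"
    by (rule Least_equality) (use v in \<open>auto simp: strict_mono_less_eq\<close>)
  then have rank_jump: "fib_rank a b (P ^ v j) = fib_rank a b P * p ^ j"
    using rank[of "v j"] \<open>e \<le> v j\<close> \<open>e \<ge> 1\<close> by simp
  have rank_e: "fib_rank a b (P ^ e) = fib_rank a b P * p ^ j"
    using rank \<open>e \<ge> 1\<close> by (simp add: j_def)
  have "fib_rank a b P = p" if "[\<Delta> = 0] (mod P)"
    using fib_rank_ramified[OF prime Pb p, of a] that \<open>\<Delta> = a\<^sup>2 + 4 * b\<close> by (simp add: cong_0_iff)
  then show ?thesis
    using \<open>rank_jump a b P j < e\<close> \<open>e \<le> v j\<close> rank_jump rank_e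
    by (intro exI[of _ "Suc j"]) (simp add: jump mult.commute del: rank_jump.simps)
qed

end
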